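(* Let $\varphi$ be an increasing concave function on the interval $[0,1]$ such that $\varphi(0)=0$. If $\Lambda_\varphi\in\mathbb{K}$, then $\Lambda_\varphi\supset\exp L_1$.
   Context: All spaces consist of measurable functions on $[0,1]$ with Lebesgue measure; $x^*$ denotes the non-increasing left-continuous rearrangement of $|x|$. The Lorentz space $\Lambda_\varphi$ consists of all measurable $x$ with $\|x\|_{\Lambda_\varphi}=\int_0^1x^*(t)\,d\varphi(t)<\infty$. The space $\exp L_1$ is the Orlicz space $L_M$ with $M(u)=e^u-1$ and norm $\|x\|_{L_M}=\inf\{\lambda>0:\int_0^1M(|x(t)|/\lambda)\,dt\le1\}$. Kruglov property. For a measurable function (random variable) $f$ on $[0,1]$, $\pi(f)$ denotes a random variable $\sum_{i=1}^N f_i$, where the $f_i$ are independent copies of $f$ and $N$ is a Poisson random variable with parameter 1 independent of the $f_i$. A rearrangement invariant Banach function space $E$ on $[0,1]$ has the Kruglov property, written $E\in\mathbb{K}$, if $f\in E\Longleftrightarrow\pi(f)\in E$ (meaning that functions on $[0,1]$ with the distribution of $\pi(f)$ belong to $E$). *)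

theory Defs
  imports "HOL-Probability.Probability"
begin

abbreviation unit_interval :: "real measure" where
  "unit_interval \<equiv> lebesgue_on {0..1}"

definition distribution_fun :: "(real \<Rightarrow> real) \<Rightarrow> real \<Rightarrow> real" where
  "distribution_fun x \<tau> = measure unit_interval {s \<in> {0..1}. \<tau> < \<bar>x s\<bar>}"

(* Left-continuous on {0<..1}.  The second disjunct is redundant for t > 0; at t = 0 it
   makes the value x*(0) = x*(0+) = ess sup |x| instead of the infimum of the empty set. *)
definition rearrangement :: "(real \<Rightarrow> real) \<Rightarrow> real \<Rightarrow> ennreal" where
  "rearrangement x t =
     (INF \<tau>\<in>{\<tau>. 0 \<le> \<tau> \<and> (distribution_fun x \<tau> < t \<or> distribution_fun x \<tau> = 0)}. ennreal \<tau>)"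

(* The right-continuous version of phi, extended by phi(0) = 0 to the left of 0 and by phi(1)
   to the right of 1.  An increasing concave phi may jump at 0; the measure d(phi) then has
   an atom of mass phi(0+) there, and interval_measure needs a right-continuous function. *)
definition rc_extension :: "(real \<Rightarrow> real) \<Rightarrow> real \<Rightarrow> real" where
  "rc_extension \<phi> t = (if t < 0 then 0 else INF s\<in>{t<..}. \<phi> (min s 1))"

definition lorentz_norm :: "(real \<Rightarrow> real) \<Rightarrow> (real \<Rightarrow> real) \<Rightarrow> ennreal" where
  "lorentz_norm \<phi> x =
     (\<integral>\<^sup>+ t\<in>{0..1}. rearrangement x t \<partial>interval_measure (rc_extension \<phi>))"

definition lorentz_space :: "(real \<Rightarrow> real) \<Rightarrow> (real \<Rightarrow> real) set" where
  "lorentz_space \<phi> = {x \<in> borel_measurable unit_interval. lorentz_norm \<phi> x < \<infinity>}"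

definition orlicz_norm :: "(real \<Rightarrow> real) \<Rightarrow> (real \<Rightarrow> real) \<Rightarrow> ennreal" where
  "orlicz_norm M x =
     (INF c\<in>{c. 0 < c \<and> (\<integral>\<^sup>+ t. ennreal (M (\<bar>x t\<bar> / c)) \<partial>unit_interval) \<le> 1}. ennreal c)"

definition orlicz_space :: "(real \<Rightarrow> real) \<Rightarrow> (real \<Rightarrow> real) set" where
  "orlicz_space M = {x \<in> borel_measurable unit_interval. orlicz_norm M x < \<infinity>}"

definition exp_L1 :: "(real \<Rightarrow> real) set" where
  "exp_L1 = orlicz_space (\<lambda>u. exp u - 1)"

(* The canonical model of N and independent copies f_0, f_1, ... of f: a Poisson variable N,
   and, independent of it, an i.i.d. sequence of points u_i of [0,1], with f_i = f(u_i). *)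
definition kruglov_model :: "(nat \<times> (nat \<Rightarrow> real)) measure" where
  "kruglov_model = measure_pmf (poisson_pmf 1) \<Otimes>\<^sub>M (\<Pi>\<^sub>M i\<in>UNIV. unit_interval)"

definition kruglov_sum :: "(real \<Rightarrow> real) \<Rightarrow> nat \<times> (nat \<Rightarrow> real) \<Rightarrow> real" where
  "kruglov_sum f = (\<lambda>(N, u). \<Sum>i<N. f (u i))"

(* Meant for rearrangement invariant E, where it makes no difference whether all or some of
   the functions g on [0,1] distributed as pi(f) are required to lie in E: such g exist. *)
definition kruglov_property :: "(real \<Rightarrow> real) set \<Rightarrow> bool" where
  "kruglov_property E \<longleftrightarrow>
     (\<forall>f \<in> borel_measurable unit_interval.
        f \<in> E \<longleftrightarrow>
        (\<forall>g \<in> borel_measurable unit_interval.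
           distr unit_interval borel g = distr kruglov_model borel (kruglov_sum f) \<longrightarrow> g \<in> E))"

end

theory Submission
  imports Defs
begin

text \<open>
Write \<open>\<psi>\<close> for the right-continuous version of \<open>\<phi>\<close>. Since \<open>\<psi>(t)\<close> is the \<open>d\<phi>\<close>-mass of
\<open>[0,t]\<close>, the Lorentz norm of a function is governed by the sum of \<open>\<psi>\<close> over the measures of its level
sets. The functions in \<open>exp L\<^sub>1\<close> have exponential tails, so that \<open>x\<^sup>*(t)\<close> is at most a constant
times \<open>log (2/t)\<close>, and all of them lie in the Lorentz space as soon as the sequence
\<open>d(m) = \<psi>(2\<^sup>-\<^sup>m)\<close> is summable (\<open>exp_L1_subset_lorentz_space\<close>).

The Kruglov property enters through multiples of indicators of small intervals. If
\<open>f \<ge> 0\<close> and \<open>f \<ge> c\<close> on an interval of length \<open>q\<close>, then \<open>\<pi>(f) \<ge> c k\<close> with probability at least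
\<open>q\<^sup>k / (e k!)\<close>, because \<open>N\<close> may be \<open>k\<close> and all \<open>k\<close> points may fall into the interval. For
\<open>q = 2\<^sup>-\<^sup>s / 2\<close>, \<open>s \<ge> 2\<close> and \<open>1 \<le> k \<le> 2\<^sup>s\<close> the factorial costs no more than another factor \<open>2\<^sup>-\<^sup>s\<^sup>k\<close>, and the
probability is at least \<open>2\<^sup>-\<^sup>4\<^sup>s\<^sup>k\<close>. If the quotients of \<open>d(4s) + d(8s) + \<dots> + d(4s 2\<^sup>s)\<close> by
\<open>d(s)\<close> were unbounded as \<open>s \<rightarrow> \<infinity>\<close>, a gliding hump would give a function in the space whose
Kruglov sum is outside of it. Hence there is a constant \<open>C\<close> with
\<open>d(4s) + d(8s) + \<dots> + d(4s 2\<^sup>s) \<le> C d(s)\<close> for all large \<open>s\<close> (\<open>kruglov_dilation_bound\<close>).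

What makes this inequality strong enough is the exponential length of its left-hand side. In terms
of the condensed sequence \<open>\<beta>(j) = 2\<^sup>j d(2\<^sup>j)\<close> it says that \<open>\<beta>(j)\<close>, up to a constant,
dominates the sum of the next \<open>j\<close> terms. A nonnegative sequence that, up to a fixed constant,
eventually dominates arbitrarily long windows of its successors decays geometrically, so \<open>\<beta>\<close> is
summable, and \<open>d\<close> is summable by
Cauchy condensation (\<open>summable_if_dilation_bounded\<close>).
\<close>

section \<open>Summability from dilation inequalities\<close>

text \<open>
The partial sums \<open>S\<close> from \<open>J\<close> on satisfy \<open>S(m + n) \<le> S(m) + S(n) / 2\<close>, which bounds them
by \<open>2 S(m)\<close>.
\<close>
lemma summable_if_eventually_halving:
  fixes \<beta> :: "nat \<Rightarrow> real"
  assumes nonneg: "\<And>j. 0 \<le> \<beta> j"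
    and halving: "\<And>j. J \<le> j \<Longrightarrow> \<beta> (j + m) \<le> \<beta> j / 2"
  shows "summable \<beta>"
proof -
  let ?S = "\<lambda>n. \<Sum>i<n. \<beta> (i + J)"
  have split: "?S (m + n) = ?S m + (\<Sum>i<n. \<beta> (i + J + m))" for n
    by (induction n) (simp_all add: ac_simps)
  have "?S n \<le> 2 * ?S m" for n
  proof -
    have "(\<Sum>i<n. \<beta> (i + J + m)) \<le> (\<Sum>i<n. \<beta> (i + J) / 2)"
      by (intro sum_mono halving) simp
    also have "\<dots> = ?S n / 2"
      by (simp add: sum_divide_distrib)
    finally have "?S (m + n) \<le> ?S m + ?S n / 2"
      using split by simp
    moreover have "?S n \<le> ?S (m + n)"
      by (intro sum_mono2) (auto simp: nonneg)
    ultimately show ?thesis by simp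
  qed
  then have "summable (\<lambda>i. \<beta> (i + J))"
    by (intro summableI_nonneg_bounded) (auto simp: nonneg)
  then show ?thesis
    using summable_iff_shift by blast
qed

text \<open>
Up to the factor \<open>K\<close>, each term of a window of length \<open>m\<close> dominates the last one, by the inequality
for the shorter window that follows it, while the whole window is dominated by the term before it. So \<open>m \<beta>(j + m)\<close> is at
most \<open>K\<^sup>2 \<beta>(j)\<close>, and for \<open>m \<ge> 2 K\<^sup>2\<close> the sequence halves every \<open>m\<close> steps.
\<close>
lemma summable_if_windows_controlled:
  fixes \<beta> :: "nat \<Rightarrow> real"
  assumes nonneg: "\<And>j. 0 \<le> \<beta> j"
    and windows: "\<And>m. \<exists>J. \<forall>j\<ge>J. \<forall>l\<le>m. (\<Sum>i=1..l. \<beta> (j + i)) \<le> C * \<beta> j"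
  shows "summable \<beta>"
proof -
  \<comment> \<open>\<open>K \<ge> 1\<close> makes the last term of a window dominated by \<open>K\<close> times itself.\<close>
  define K where "K = max C 1"
  define m where "m = Suc (nat \<lceil>2 * K\<^sup>2\<rceil>)"
  obtain J where J: "\<And>j l. J \<le> j \<Longrightarrow> l \<le> m \<Longrightarrow> (\<Sum>i=1..l. \<beta> (j + i)) \<le> C * \<beta> j"
    using windows by meson
  have K: "1 \<le> K" "C \<le> K" by (auto simp: K_def)
  have window: "(\<Sum>i=1..l. \<beta> (j + i)) \<le> K * \<beta> j" if "J \<le> j" "l \<le> m" for j l
    using J[OF that] mult_right_mono[OF K(2) nonneg[of j]] by linarith
  show ?thesis
  proof (rule summable_if_eventually_halving[where m = m and J = J])
    fix j assume j: "J \<le> j"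
    have last: "\<beta> (j + m) \<le> K * \<beta> (j + i)" if i: "i \<in> {1..m}" for i
    proof (cases "i = m")
      case True
      then show ?thesis
        using mult_right_mono[OF K(1) nonneg[of "j + m"]] by simp
    next
      case False
      with i have "\<beta> (j + i + (m - i)) \<le> (\<Sum>k=1..m - i. \<beta> (j + i + k))"
        by (intro member_le_sum[of "m - i" _ "\<lambda>k. \<beta> (j + i + k)"] nonneg) auto
      with i have "\<beta> (j + m) \<le> (\<Sum>k=1..m - i. \<beta> (j + i + k))" by simp
      also have "\<dots> \<le> K * \<beta> (j + i)"
        using j by (intro window) auto
      finally show ?thesis .
    qed
    have "real m * \<beta> (j + m) = (\<Sum>i=1..m. \<beta> (j + m))"
      by simp
    also have "\<dots> \<le> (\<Sum>i=1..m. K * \<beta> (j + i))"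
      by (intro sum_mono last)
    also have "\<dots> = K * (\<Sum>i=1..m. \<beta> (j + i))"
      by (simp add: sum_distrib_left)
    also have "\<dots> \<le> K * (K * \<beta> j)"
      using j K by (intro mult_left_mono window) auto
    finally have "real m * \<beta> (j + m) \<le> K\<^sup>2 * \<beta> j"
      by (simp add: power2_eq_square)
    moreover have "2 * K\<^sup>2 * \<beta> (j + m) \<le> real m * \<beta> (j + m)"
      using nonneg by (intro mult_right_mono) (auto simp: m_def, linarith)
    ultimately have "K\<^sup>2 * (2 * \<beta> (j + m)) \<le> K\<^sup>2 * \<beta> j"
      by (simp add: algebra_simps)
    then show "\<beta> (j + m) \<le> \<beta> j / 2"
      using K by (subst (asm) mult_le_cancel_left_pos) auto
  qed (rule nonneg)
qed

lemma dyadic_blocks_le_sum: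
  fixes e :: "nat \<Rightarrow> real"
  assumes "antimono e"
  shows "(\<Sum>i=1..m. 2 ^ (i - 1) * e (2 ^ i)) \<le> (\<Sum>k=2..2 ^ m. e k)"
proof (induction m)
  case (Suc m)
  have "2 ^ m * e (2 ^ Suc m) = (\<Sum>k\<in>{2 ^ m<..2 ^ Suc m :: nat}. e (2 ^ Suc m))"
    by simp
  also have "\<dots> \<le> (\<Sum>k\<in>{2 ^ m<..2 ^ Suc m}. e k)"
    using assms by (intro sum_mono) (auto simp: antimono_def)
  finally have block: "2 ^ m * e (2 ^ Suc m) \<le> (\<Sum>k\<in>{2 ^ m<..2 ^ Suc m}. e k)" .
  have "{2..2 ^ Suc m} = {2..2 ^ m} \<union> {2 ^ m<..2 ^ Suc m :: nat}"
    using one_le_power[of "2::nat" m] by (auto simp del: one_le_power)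
  then have "(\<Sum>k=2..2 ^ Suc m. e k) = (\<Sum>k=2..2 ^ m. e k) + (\<Sum>k\<in>{2 ^ m<..2 ^ Suc m}. e k)"
    by (simp only:) (subst sum.union_disjoint, auto)
  with Suc block show ?case by simp
qed simp

text \<open>
With \<open>s = 2\<^sup>j\<close>, grouping the left-hand side into dyadic blocks of \<open>k\<close> turns the hypothesis into a bound
on the windows of the condensed sequence \<open>\<beta>\<close>. The length \<open>2\<^sup>s\<close> of the sum leaves room for at least
\<open>j\<close> dyadic blocks, so the windows become arbitrarily long.
\<close>
lemma summable_if_dilation_bounded:
  fixes d :: "nat \<Rightarrow> real"
  assumes d: "antimono d" "\<And>n. 0 \<le> d n"
    and bound: "\<And>s. S \<le> s \<Longrightarrow> (\<Sum>k=1..2 ^ s. d (4 * s * k)) \<le> C * d s"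
  shows "summable d"
proof -
  define \<beta> where "\<beta> j = 2 ^ j * d (2 ^ j)" for j :: nat
  have \<beta>: "0 \<le> \<beta> j" for j by (simp add: \<beta>_def d)
  have step: "\<beta> (Suc j) \<le> 2 * \<beta> j" for j
    using antimonoD[OF d(1), of "2 ^ j" "2 ^ Suc j"] by (simp add: \<beta>_def)
  have window: "(\<Sum>i=1..l. \<beta> (j + i)) \<le> (8 * C + 6) * \<beta> j" if j: "S \<le> j" "l \<le> j" for j l
  proof -
    have j_lt: "j < 2 ^ j" by (rule less_exp)
    have "2 ^ (i - 1) * d (4 * 2 ^ j * 2 ^ i) = \<beta> (j + i + 2) / (8 * 2 ^ j)"
      if "i \<in> {1..l}" for i
      using that by (cases i) (auto simp: \<beta>_def power_add field_simps)
    then have "(\<Sum>i=1..l. \<beta> (j + i + 2)) / (8 * 2 ^ j)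
        = (\<Sum>i=1..l. 2 ^ (i - 1) * d (4 * 2 ^ j * 2 ^ i))"
      by (simp add: sum_divide_distrib)
    also have "\<dots> \<le> (\<Sum>k=2..2 ^ l. d (4 * 2 ^ j * k))"
      by (intro dyadic_blocks_le_sum antimonoI antimonoD[OF d(1)]) simp
    also have "\<dots> \<le> (\<Sum>k=1..2 ^ 2 ^ j. d (4 * 2 ^ j * k))"
    proof (intro sum_mono2)
      have "(2::nat) ^ l \<le> 2 ^ 2 ^ j"
        using j less_imp_le[OF j_lt] by (intro power_increasing) (auto intro: order_trans)
      then show "{2..2 ^ l} \<subseteq> {1..2 ^ 2 ^ j :: nat}" by auto
    qed (auto simp: d)
    also have "\<dots> \<le> C * d (2 ^ j)"
      using j less_imp_le[OF j_lt] by (intro bound) (auto intro: order_trans)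
    also have "\<dots> = C * \<beta> j / 2 ^ j" by (simp add: \<beta>_def)
    finally have shifted: "(\<Sum>i=1..l. \<beta> (j + i + 2)) \<le> 8 * C * \<beta> j"
      by (simp add: field_simps)
    \<comment> \<open>The factor 4 in \<open>d (4 * s * k)\<close> shifts the window by two places; monotonicity of \<open>d\<close>
      bounds the two terms in front of it.\<close>
    have "(\<Sum>i=1..l. \<beta> (j + i)) \<le> (\<Sum>i=1..l + 2. \<beta> (j + i))"
      by (intro sum_mono2) (auto simp: \<beta>)
    also have "\<dots> = \<beta> (j + 1) + \<beta> (j + 2) + (\<Sum>i=1..l. \<beta> (j + i + 2))"
      by (induction l) (auto simp: numeral_2_eq_2)
    also have "\<dots> \<le> 2 * \<beta> j + 4 * \<beta> j + 8 * C * \<beta> j"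
      using step[of j] step[of "Suc j"] shifted by (auto intro!: add_mono)
    finally show ?thesis by (simp add: algebra_simps)
  qed
  have "summable \<beta>"
  proof (rule summable_if_windows_controlled[OF \<beta>])
    show "\<exists>J. \<forall>j\<ge>J. \<forall>l\<le>m. (\<Sum>i=1..l. \<beta> (j + i)) \<le> (8 * C + 6) * \<beta> j" for m
      by (intro exI[of _ "max S m"] allI impI window) auto
  qed
  then show ?thesis
    unfolding \<beta>_def by (subst condensation_test) (auto intro!: d antimonoD[OF d(1)])
qed

section \<open>Rearrangements and the Lorentz norm\<close>

lemma prob_space_unit_interval: "prob_space unit_interval"
  by (rule prob_spaceI) (simp add: emeasure_restrict_space)

lemma measure_unit_interval:
  assumes "A \<subseteq> {0..1}"
  shows "measure unit_interval A = measure lebesgue A"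
  using assms by (intro measure_restrict_space) auto

lemma rearrangement_le:
  assumes "0 \<le> \<tau>" "distribution_fun x \<tau> < t \<or> distribution_fun x \<tau> = 0"
  shows "rearrangement x t \<le> ennreal \<tau>"
  unfolding rearrangement_def using assms by (intro INF_lower) auto

lemma le_rearrangement:
  assumes "\<And>\<tau>. 0 \<le> \<tau> \<Longrightarrow> \<tau> < b \<Longrightarrow> p \<le> distribution_fun x \<tau>" "0 < p" "t \<le> p"
  shows "ennreal b \<le> rearrangement x t"
  unfolding rearrangement_def
proof (rule INF_greatest)
  fix \<tau> assume "\<tau> \<in> {\<tau>. 0 \<le> \<tau> \<and> (distribution_fun x \<tau> < t \<or> distribution_fun x \<tau> = 0)}"
  then have "b \<le> \<tau>"
    using assms(1)[of \<tau>] assms(2,3) by fastforce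
  then show "ennreal b \<le> ennreal \<tau>" by (rule ennreal_leI)
qed

locale lorentz_weight =
  fixes \<phi> :: "real \<Rightarrow> real"
  assumes mono: "mono_on {0..1} \<phi>" and zero: "\<phi> 0 = 0"
begin

abbreviation "\<psi> \<equiv> rc_extension \<phi>"

lemma \<phi>_min_mono: "0 \<le> s \<Longrightarrow> s \<le> t \<Longrightarrow> \<phi> (min s 1) \<le> \<phi> (min t 1)"
  by (intro mono_onD[OF mono]) auto

lemma \<phi>_min_nonneg: "0 \<le> s \<Longrightarrow> 0 \<le> \<phi> (min s 1)"
  using \<phi>_min_mono[of 0 s] zero by simp

lemma \<phi>_min_bdd_below: "0 \<le> t \<Longrightarrow> bdd_below ((\<lambda>s. \<phi> (min s 1)) ` {t<..})"
  by (rule bdd_belowI2[where m = 0]) (auto intro: \<phi>_min_nonneg)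

lemma weight_nonneg: "0 \<le> \<psi> t"
  unfolding rc_extension_def by (auto intro!: cINF_greatest \<phi>_min_nonneg)

lemma weight_le: "0 \<le> t \<Longrightarrow> t < s \<Longrightarrow> \<psi> t \<le> \<phi> (min s 1)"
  unfolding rc_extension_def by (auto intro!: cINF_lower \<phi>_min_bdd_below)

lemma weight_mono: "s \<le> t \<Longrightarrow> \<psi> s \<le> \<psi> t"
proof (cases "s < 0")
  case True
  then show ?thesis using weight_nonneg[of t] by (simp add: rc_extension_def)
next
  case False
  assume "s \<le> t"
  with False have "\<psi> s \<le> (INF s\<in>{t<..}. \<phi> (min s 1))"
    by (intro cINF_greatest weight_le) auto
  with False \<open>s \<le> t\<close> show ?thesis by (simp add: rc_extension_def)
qed

lemma weight_right_continuous: "continuous (at_right t) \<psi>"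
proof (subst continuous_at_right_real_increasing)
  show "\<forall>e>0. \<exists>d>0. \<psi> (t + d) - \<psi> t < e"
  proof (intro allI impI)
    fix e :: real assume e: "0 < e"
    show "\<exists>d>0. \<psi> (t + d) - \<psi> t < e"
    proof (cases "t < 0")
      case True
      then show ?thesis
        using e by (intro exI[of _ "- t / 2"]) (auto simp: rc_extension_def)
    next
      case False
      then have "(INF s\<in>{t<..}. \<phi> (min s 1)) < \<psi> t + e"
        using e by (simp add: rc_extension_def)
      then obtain s where s: "t < s" "\<phi> (min s 1) < \<psi> t + e"
        using False by (subst (asm) cINF_less_iff) (auto intro: \<phi>_min_bdd_below)
      then have "\<psi> (t + (s - t) / 2) \<le> \<phi> (min s 1)"
        using False by (intro weight_le) (auto simp: field_simps)
      with s show ?thesis by (intro exI[of _ "(s - t) / 2"]) auto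
    qed
  qed
qed (rule weight_mono)

text \<open>
A jump of \<open>\<phi>\<close> at 0 is an atom of the measure at the left end of this closed interval; passing to
\<open>{-1<..a}\<close> collects it, because \<open>\<psi>\<close> vanishes to the left of 0.
\<close>
lemma emeasure_weight_Icc:
  assumes "0 \<le> a"
  shows "emeasure (interval_measure \<psi>) {0..a} = ennreal (\<psi> a)"
proof -
  let ?\<mu> = "interval_measure \<psi>"
  note Ioc = emeasure_interval_measure_Ioc_eq[OF weight_mono weight_right_continuous]
  have "{-1<..<0} = (\<Union>n. {-1<..- (1 / real (Suc n))})"
  proof (intro equalityI subsetI)
    fix x :: real assume x: "x \<in> {-1<..<0}"
    then obtain n where "1 / real (Suc n) < - x"
      using nat_approx_posE[of "- x"] by auto
    with x show "x \<in> (\<Union>n. {-1<..- (1 / real (Suc n))})"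
      by (intro UN_I[of n]) auto
  next
    fix x assume "x \<in> (\<Union>n. {-1<..- (1 / real (Suc n))})"
    then obtain n where "-1 < x" "x \<le> - (1 / real (Suc n))" by auto
    moreover have "0 < 1 / real (Suc n)" by simp
    ultimately have "x < 0" by linarith
    with \<open>-1 < x\<close> show "x \<in> {-1<..<0}" by simp
  qed
  moreover have "{-1<..- (1 / real (Suc n))} \<in> null_sets ?\<mu>" for n
    by (rule null_setsI) (auto simp: Ioc rc_extension_def)
  ultimately have null: "{-1<..<0} \<in> null_sets ?\<mu>"
    by (simp only:) (rule null_sets_UN, auto)
  have "emeasure ?\<mu> {0..a} = emeasure ?\<mu> ({0..a} \<union> {-1<..<0})"
    using null by (intro emeasure_Un_null_set[symmetric]) auto
  also have "{0..a} \<union> {-1<..<0} = {-1<..a}" using assms by auto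
  also have "emeasure ?\<mu> {-1<..a} = ennreal (\<psi> a)"
    using assms by (auto simp: Ioc rc_extension_def)
  finally show ?thesis .
qed

text \<open>
The majorants below are sums of indicators of initial intervals, whose integrals are explicit.
At \<open>t = 0\<close> the series may be infinite, which covers unbounded functions whose rearrangement is
infinite there.
\<close>
lemma lorentz_norm_le:
  fixes c :: "nat \<Rightarrow> ennreal"
  assumes a: "\<And>k. 0 \<le> a k" "\<And>k. a k \<le> 1"
    and le: "\<And>t. t \<in> {0..1} \<Longrightarrow> rearrangement x t \<le> (\<Sum>k. c k * indicator {0..a k} t)"
  shows "lorentz_norm \<phi> x \<le> (\<Sum>k. c k * ennreal (\<psi> (a k)))"
proof -
  have "lorentz_norm \<phi> x \<le> (\<integral>\<^sup>+ t. (\<Sum>k. c k * indicator {0..a k} t) \<partial>interval_measure \<psi>)"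
    unfolding lorentz_norm_def
    by (intro nn_integral_mono) (use le in \<open>auto split: split_indicator\<close>)
  also have "\<dots> = (\<Sum>k. \<integral>\<^sup>+ t. c k * indicator {0..a k} t \<partial>interval_measure \<psi>)"
    by (intro nn_integral_suminf) auto
  also have "\<dots> = (\<Sum>k. c k * ennreal (\<psi> (a k)))"
    using a by (simp add: nn_integral_cmult_indicator emeasure_weight_Icc)
  finally show ?thesis .
qed

text \<open>
If \<open>t \<le> p k\<close> holds for \<open>r\<close> indices \<open>k\<close>, then the largest of them is at least \<open>r\<close>, so that
\<open>x\<^sup>*(t) \<ge> c r\<close>: the rearrangement dominates \<open>c\<close> times the sum of the indicators of the
intervals \<open>{0..p k}\<close>.
\<close>
lemma le_lorentz_norm:
  assumes p: "\<And>k. k \<in> {1..K} \<Longrightarrow> 0 < p k" "\<And>k. k \<in> {1..K} \<Longrightarrow> p k \<le> 1" and c: "0 \<le> c"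
    and tail: "\<And>k \<tau>. k \<in> {1..K} \<Longrightarrow> 0 \<le> \<tau> \<Longrightarrow> \<tau> < c * real k \<Longrightarrow> p k \<le> distribution_fun x \<tau>"
  shows "ennreal (c * (\<Sum>k=1..K. \<psi> (p k))) \<le> lorentz_norm \<phi> x"
proof -
  have pointwise: "ennreal c * (\<Sum>k=1..K. indicator {0..p k} t) \<le> rearrangement x t"
    if t: "0 \<le> t" for t
  proof -
    define L where "L = {k \<in> {1..K}. t \<le> p k}"
    have "(\<Sum>k=1..K. indicator {0..p k} t :: ennreal) = (\<Sum>k\<in>L. 1)"
      unfolding L_def using t by (subst sum.inter_filter) (auto intro!: sum.cong split: split_indicator)
    then have count: "(\<Sum>k=1..K. indicator {0..p k} t :: ennreal) = ennreal (real (card L))"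
      by (simp add: ennreal_of_nat_eq_real_of_nat)
    show ?thesis
    proof (cases "L = {}")
      case False
      have fin: "finite L" by (simp add: L_def)
      have in_L: "Max L \<in> L" using fin False by simp
      have "L \<subseteq> {1..Max L}"
        using fin by (auto simp: L_def)
      then have "card L \<le> Max L"
        using card_mono[of "{1..Max L}" L] by simp
      then have "ennreal (c * real (card L)) \<le> ennreal (c * real (Max L))"
        using c by (intro ennreal_leI mult_left_mono) auto
      also have "\<dots> \<le> rearrangement x t"
        using in_L by (intro le_rearrangement[where p = "p (Max L)"] tail p) (auto simp: L_def)
      finally show ?thesis
        using c unfolding count by (simp add: ennreal_mult)
    qed (use count in simp)
  qed
  have "ennreal (c * (\<Sum>k=1..K. \<psi> (p k))) =
      ennreal c * (\<Sum>k=1..K. emeasure (interval_measure \<psi>) {0..p k})"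
    using p c by (simp add: ennreal_mult sum_nonneg weight_nonneg emeasure_weight_Icc less_imp_le)
  also have "\<dots> = (\<integral>\<^sup>+ t. ennreal c * (\<Sum>k=1..K. indicator {0..p k} t) \<partial>interval_measure \<psi>)"
    by (simp add: nn_integral_cmult nn_integral_sum)
  also have "\<dots> \<le> lorentz_norm \<phi> x"
    unfolding lorentz_norm_def
  proof (rule nn_integral_mono)
    fix t
    have "\<not> (0 \<le> t \<and> t \<le> 1) \<Longrightarrow> (\<Sum>k=1..K. indicator {0..p k} t :: ennreal) = 0"
      using p(2) by (intro sum.neutral) (force split: split_indicator)
    then show "ennreal c * (\<Sum>k=1..K. indicator {0..p k} t) \<le> rearrangement x t * indicator {0..1} t"
      using pointwise[of t] by (cases "0 \<le> t \<and> t \<le> 1") auto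
  qed
  finally show ?thesis .
qed

end

section \<open>Exponentially integrable functions\<close>

text \<open>
Markov's inequality for the modular of the Orlicz space.
\<close>
lemma exp_L1_distribution_fun_le:
  assumes "x \<in> exp_L1"
  obtains c where "0 < c" "\<And>\<tau>. distribution_fun x \<tau> * (exp (\<tau> / c) - 1) \<le> 1"
proof -
  interpret U: prob_space unit_interval by (rule prob_space_unit_interval)
  have x[measurable]: "x \<in> borel_measurable unit_interval"
    and "orlicz_norm (\<lambda>u. exp u - 1) x < \<infinity>"
    using assms by (auto simp: exp_L1_def orlicz_space_def)
  then obtain c where c: "0 < c"
    and int: "(\<integral>\<^sup>+ t. ennreal (exp (\<bar>x t\<bar> / c) - 1) \<partial>unit_interval) \<le> 1"
    unfolding orlicz_norm_def by (auto simp: INF_less_iff)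
  have "distribution_fun x \<tau> * (exp (\<tau> / c) - 1) \<le> 1" for \<tau>
  proof (cases "0 \<le> \<tau>")
    case True
    let ?A = "{s \<in> {0..1}. \<tau> < \<bar>x s\<bar>}"
    have A: "?A \<in> sets unit_interval"
    proof -
      have "{s \<in> space unit_interval. \<tau> < \<bar>x s\<bar>} \<in> sets unit_interval" by measurable
      then show ?thesis by simp
    qed
    have nn: "0 \<le> exp (\<tau> / c) - 1" using True c by simp
    have "ennreal (distribution_fun x \<tau> * (exp (\<tau> / c) - 1))
        = (\<integral>\<^sup>+ t. ennreal (exp (\<tau> / c) - 1) * indicator ?A t \<partial>unit_interval)"
      using A nn by (simp add: nn_integral_cmult_indicator distribution_fun_def
          U.emeasure_eq_measure ennreal_mult mult.commute)
    also have "\<dots> \<le> (\<integral>\<^sup>+ t. ennreal (exp (\<bar>x t\<bar> / c) - 1) \<partial>unit_interval)"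
      using c by (intro nn_integral_mono)
        (auto split: split_indicator intro!: ennreal_leI divide_right_mono)
    also have "\<dots> \<le> 1" by (rule int)
    finally show ?thesis by simp
  next
    case False
    then have "exp (\<tau> / c) - 1 \<le> 0" using c by (simp add: divide_le_0_iff)
    then have "distribution_fun x \<tau> * (exp (\<tau> / c) - 1) \<le> 0"
      by (intro mult_nonneg_nonpos) (auto simp: distribution_fun_def)
    then show ?thesis by simp
  qed
  with c show thesis by (rule that)
qed

context lorentz_weight
begin

text \<open>
The exponential tail gives \<open>x\<^sup>*(t) \<le> c (m + 1)\<close> when \<open>t > 2\<^sup>-\<^sup>m\<close>, and \<open>m\<close> is the number of
indices \<open>k\<close> with \<open>t \<le> 2\<^sup>-\<^sup>k\<close> when it is chosen minimal. As \<open>m \<ge> 1\<close>, \<open>x\<^sup>*\<close> is dominated by \<open>2 c\<close> times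
the sum of the indicators of the intervals \<open>[0, 2\<^sup>-\<^sup>k]\<close>.
\<close>
lemma exp_L1_subset_lorentz_space:
  assumes "summable (\<lambda>k. \<psi> ((1/2) ^ k))"
  shows "exp_L1 \<subseteq> lorentz_space \<phi>"
proof
  fix x assume x: "x \<in> exp_L1"
  then obtain c where c: "0 < c" and tail: "\<And>\<tau>. distribution_fun x \<tau> * (exp (\<tau> / c) - 1) \<le> 1"
    using exp_L1_distribution_fun_le by blast
  have "rearrangement x t \<le> (\<Sum>k. ennreal (2 * c) * indicator {0..(1/2) ^ k} t)"
    if t: "t \<in> {0..1}" for t
  proof (cases "\<forall>k. t \<le> (1/2) ^ k")
    case True
    then have "(\<Sum>k. ennreal (2 * c) * indicator {0..(1/2) ^ k} t) = (\<Sum>k. ennreal (2 * c))"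
      using t by (intro suminf_cong) auto
    also have "\<dots> = \<infinity>"
    proof (rule ccontr)
      assume "(\<Sum>k::nat. ennreal (2 * c)) \<noteq> \<infinity>"
      then have "summable (\<lambda>k::nat. 2 * c)"
        using c by (intro summable_suminf_not_top) auto
      with c show False by (simp add: summable_const_iff)
    qed
    finally show ?thesis by simp
  next
    case False
    define m where "m = (LEAST k. \<not> t \<le> (1/2) ^ k)"
    have m: "(1/2) ^ m < t"
      using LeastI_ex[of "\<lambda>k. \<not> t \<le> (1/2) ^ k"] False by (auto simp: m_def not_le)
    have below: "t \<le> (1/2) ^ k" if "k < m" for k
      using not_less_Least[of k] that by (auto simp: m_def)
    have "m \<noteq> 0" using m t by (intro notI) simp
    have "(2::real) ^ Suc m \<le> exp 1 ^ Suc m"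
      using exp_ge_add_one_self[of 1] by (intro power_mono) auto
    also have "\<dots> = exp (c * real (Suc m) / c)"
      using c by (simp add: exp_of_nat_mult[symmetric] mult.commute del: power_Suc)
    finally have "2 ^ m \<le> exp (c * real (Suc m) / c) - 1"
      unfolding power_Suc using one_le_power[of "2::real" m] by linarith
    then have "distribution_fun x (c * real (Suc m)) * 2 ^ m
        \<le> distribution_fun x (c * real (Suc m)) * (exp (c * real (Suc m) / c) - 1)"
      by (rule mult_left_mono) (simp add: distribution_fun_def)
    also have "\<dots> \<le> 1" by (rule tail)
    finally have "distribution_fun x (c * real (Suc m)) * 2 ^ m \<le> 1" .
    then have "distribution_fun x (c * real (Suc m)) \<le> (1/2) ^ m"
      by (simp add: field_simps power_divide)
    with m have "rearrangement x t \<le> ennreal (c * real (Suc m))"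
      using c by (intro rearrangement_le) auto
    also have "\<dots> \<le> ennreal (2 * c * real m)"
      using \<open>m \<noteq> 0\<close> c by (intro ennreal_leI) (cases m, auto simp: algebra_simps)
    also have "\<dots> = (\<Sum>k<m. ennreal (2 * c) * indicator {0..(1/2) ^ k} t)"
    proof -
      have "indicator {0..(1/2) ^ k} t = (1 :: ennreal)" if "k < m" for k
        using t below[OF that] by simp
      then have "(\<Sum>k<m. ennreal (2 * c) * indicator {0..(1/2) ^ k} t) = (\<Sum>k<m. ennreal (2 * c))"
        by (intro sum.cong) simp_all
      then show ?thesis
        using c by (simp add: ennreal_of_nat_eq_real_of_nat ennreal_mult[symmetric] mult.commute)
    qed
    also have "\<dots> \<le> (\<Sum>k. ennreal (2 * c) * indicator {0..(1/2) ^ k} t)"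
      by (intro sum_le_suminf) auto
    finally show ?thesis .
  qed
  then have "lorentz_norm \<phi> x \<le> (\<Sum>k. ennreal (2 * c) * ennreal (\<psi> ((1/2) ^ k)))"
    by (intro lorentz_norm_le) (auto simp: power_le_one)
  also have "\<dots> = ennreal (\<Sum>k. 2 * c * \<psi> ((1/2) ^ k))"
    using c assms by (subst suminf_ennreal2[symmetric])
      (auto simp: ennreal_mult weight_nonneg intro!: mult_nonneg_nonneg summable_mult)
  also have "\<dots> < \<infinity>" by simp
  finally show "x \<in> lorentz_space \<phi>"
    using x by (simp add: lorentz_space_def exp_L1_def orlicz_space_def)
qed

end

section \<open>Sums of a Poisson number of independent copies\<close>

text \<open>
The quantile function of \<open>M\<close>, defined on the open unit interval, has distribution \<open>M\<close> under Lebesgue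
measure; extending it by 0 to the end points changes it on a null set only.
\<close>
lemma exists_with_distribution:
  assumes "real_distribution M"
  obtains g where "g \<in> borel_measurable unit_interval" "distr unit_interval borel g = M"
proof -
  interpret cdf_distribution M
    using assms by (simp add: cdf_distribution_def)
  define g where "g u = indicat_real {0<..<1} u * I u" for u
  have borel: "g \<in> borel_measurable borel"
    unfolding g_def
    using measurable_CI by (subst (asm) borel_measurable_restrict_space_iff) auto
  then have g: "g \<in> borel_measurable unit_interval"
    by (intro measurable_restrict_space1) (simp add: measurable_completion)
  have "emeasure (distr unit_interval borel g) A = emeasure M A" if A: "A \<in> sets borel" for A
  proof -
    have inner: "{0<..<1} \<inter> I -` A = {0<..<1} \<inter> g -` A"
      by (auto simp: g_def)
    have meas: "g -` A \<in> sets borel"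
      using measurable_sets_borel[OF borel A] .
    have ends: "{0, 1} \<in> null_sets lebesgue"
      by (intro null_sets_completionI countable_imp_null_set_lborel) simp
    have "emeasure (distr unit_interval borel g) A = emeasure lebesgue ({0..1} \<inter> g -` A)"
      using A g by (simp add: emeasure_distr emeasure_restrict_space Int_commute)
    also have "\<dots> = emeasure lebesgue ({0<..<1} \<inter> g -` A)"
    proof -
      have "{0<..<1} \<inter> g -` A = {0..1} \<inter> g -` A - {0, 1}" by auto
      then show ?thesis
        using ends meas by (simp only:) (rule emeasure_Diff_null_set[symmetric], auto)
    qed
    also have "\<dots> = emeasure (distr (restrict_space lborel {0<..<1}) borel I) A"
      using A meas by (simp add: emeasure_distr emeasure_restrict_space inner space_restrict_space Int_commute)
    finally show ?thesis by (simp add: distr_I_eq_M)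
  qed
  then have "distr unit_interval borel g = M"
    by (intro measure_eqI) auto
  with g show thesis by (rule that)
qed

lemma prob_space_kruglov_model: "prob_space kruglov_model"
  unfolding kruglov_model_def
  by (intro prob_space_pair prob_space_measure_pmf prob_space_PiM prob_space_unit_interval)

lemma measurable_kruglov_sum:
  assumes [measurable]: "f \<in> borel_measurable unit_interval"
  shows "kruglov_sum f \<in> borel_measurable kruglov_model"
proof -
  have "kruglov_sum f \<in> borel_measurable (count_space UNIV \<Otimes>\<^sub>M (\<Pi>\<^sub>M i\<in>UNIV. unit_interval))"
    by (rule measurable_pair_measure_countable1) (auto simp: kruglov_sum_def)
  then show ?thesis
    unfolding kruglov_model_def by (simp cong: measurable_cong_sets sets_pair_measure_cong)
qed

text \<open>
The right-hand event contains the one where \<open>N = k\<close> and the first \<open>k\<close> points all lie in \<open>A\<close>,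
and independence gives that event the probability on the left.
\<close>
lemma kruglov_sum_tail:
  assumes f: "f \<in> borel_measurable unit_interval" "\<And>u. 0 \<le> f u"
    and A: "A \<in> sets unit_interval" "\<And>u. u \<in> A \<Longrightarrow> c \<le> f u"
    and \<tau>: "\<tau> < c * real k"
  shows "exp (-1) * measure unit_interval A ^ k / fact k
    \<le> measure kruglov_model {\<omega> \<in> space kruglov_model. \<tau> < \<bar>kruglov_sum f \<omega>\<bar>}"
proof -
  interpret U: prob_space unit_interval by (rule prob_space_unit_interval)
  interpret P: product_prob_space "\<lambda>_::nat. unit_interval" UNIV by standard
  interpret K: prob_space kruglov_model by (rule prob_space_kruglov_model)
  let ?P = "\<Pi>\<^sub>M i\<in>(UNIV :: nat set). unit_interval"
  define B where "B = {u \<in> space ?P. \<forall>i\<in>{..<k}. u i \<in> A}"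
  have B: "B \<in> sets ?P"
    unfolding B_def using A(1) by measurable
  have "emeasure ?P B = (\<Prod>i<k. emeasure unit_interval A)"
    unfolding B_def using A(1) by (intro P.emeasure_PiM_Collect) auto
  then have PB: "emeasure ?P B = ennreal (measure unit_interval A ^ k)"
    by (simp add: U.emeasure_eq_measure ennreal_power)
  have "emeasure kruglov_model ({k} \<times> B) = emeasure (measure_pmf (poisson_pmf 1)) {k} * emeasure ?P B"
    unfolding kruglov_model_def using B by (intro P.emeasure_pair_measure_Times) auto
  also have "\<dots> = ennreal (exp (-1) * measure unit_interval A ^ k / fact k)"
    by (simp add: PB emeasure_pmf_single ennreal_mult[symmetric])
  finally have "exp (-1) * measure unit_interval A ^ k / fact k = measure kruglov_model ({k} \<times> B)"
    by (simp add: measure_def)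
  also have "\<dots> \<le> measure kruglov_model {\<omega> \<in> space kruglov_model. \<tau> < \<bar>kruglov_sum f \<omega>\<bar>}"
  proof (rule K.finite_measure_mono)
    show "{k} \<times> B \<subseteq> {\<omega> \<in> space kruglov_model. \<tau> < \<bar>kruglov_sum f \<omega>\<bar>}"
    proof clarify
      fix u assume u: "u \<in> B"
      have "c * real k = (\<Sum>i<k. c)" by simp
      also have "\<dots> \<le> (\<Sum>i<k. f (u i))"
        using u by (intro sum_mono A(2)) (auto simp: B_def)
      finally have "\<tau> < \<bar>kruglov_sum f (k, u)\<bar>"
        using \<tau> by (simp add: kruglov_sum_def)
      moreover have "(k, u) \<in> space kruglov_model"
        using u by (simp add: kruglov_model_def B_def space_pair_measure)
      ultimately show "(k, u) \<in> space kruglov_model \<and> \<tau> < \<bar>kruglov_sum f (k, u)\<bar>" by simp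
    qed
    show "{\<omega> \<in> space kruglov_model. \<tau> < \<bar>kruglov_sum f \<omega>\<bar>} \<in> sets kruglov_model"
      using measurable_kruglov_sum[OF f(1)] by measurable
  qed
  finally show ?thesis .
qed

text \<open>
For \<open>k \<le> 2\<^sup>s\<close> one has \<open>k! \<le> k\<^sup>k \<le> 2\<^sup>s\<^sup>k\<close>, so the factorial is absorbed by a power of the same order
as the one coming from the interval length.
\<close>
lemma poisson_tail_dyadic:
  fixes s k :: nat
  assumes "2 \<le> s" "k \<in> {1..2 ^ s}"
  shows "(1/2) ^ (4 * s * k) \<le> exp (-1) * ((1/2) ^ s / 2) ^ k / (fact k :: real)"
proof -
  have "fact k \<le> (real k) ^ k"
    using fact_le_power[of k, where 'a = real] by simp
  also have "\<dots> \<le> (2 ^ s) ^ k"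
    using assms by (intro power_mono) (auto simp: of_nat_le_iff[symmetric] simp del: of_nat_le_iff)
  finally have fact: "fact k \<le> (2::real) ^ (s * k)" by (simp add: power_mult)
  have exp: "exp 1 \<le> (2::real) ^ 2" using exp_le by simp
  have "exp 1 * (2 ^ s * 2) ^ k * fact k \<le> (2::real) ^ 2 * (2 ^ s * 2) ^ k * 2 ^ (s * k)"
    by (intro mult_mono fact exp) auto
  also have "\<dots> = 2 ^ (2 + (s + 1) * k + s * k)"
    by (simp add: power_add power_mult power_mult_distrib)
  also have "\<dots> \<le> 2 ^ (4 * s * k)"
  proof (rule power_increasing)
    have "2 * k \<le> s * k" using assms by simp
    moreover have "1 \<le> k" using assms by simp
    moreover have "(s + 1) * k = s * k + k" "4 * s * k = 4 * (s * k)" by simp_all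
    ultimately show "2 + (s + 1) * k + s * k \<le> 4 * s * k" by linarith
  qed simp
  finally show ?thesis
    by (simp add: exp_minus power_divide field_simps)
qed

context lorentz_weight
begin

lemma kruglov_sum_lorentz_norm_ge:
  assumes g: "g \<in> borel_measurable unit_interval"
      "distr unit_interval borel g = distr kruglov_model borel (kruglov_sum f)"
    and f: "f \<in> borel_measurable unit_interval" "\<And>u. 0 \<le> f u"
      "\<And>u. u \<in> {0<..(1/2) ^ s / 2} \<Longrightarrow> c \<le> f u"
    and "0 \<le> c" "2 \<le> s"
  shows "ennreal (c * (\<Sum>k=1..2 ^ s. \<psi> ((1/2) ^ (4 * s * k)))) \<le> lorentz_norm \<phi> g"
proof (rule le_lorentz_norm)
  fix k :: nat and \<tau> :: real assume k: "k \<in> {1..2 ^ s}" and \<tau>: "0 \<le> \<tau>" "\<tau> < c * real k"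
  let ?A = "{0<..(1/2) ^ s / 2 :: real}"
  have "(1/2) ^ s / 2 \<le> (1 :: real)"
    using power_le_one[of "1/2 :: real" s] by simp
  then have A: "?A \<subseteq> {0..1}" by auto
  then have "?A \<in> sets unit_interval"
    by (auto simp: sets_restrict_space image_iff intro!: bexI[of _ ?A])
  then have "exp (-1) * measure unit_interval ?A ^ k / fact k
      \<le> measure kruglov_model {\<omega> \<in> space kruglov_model. \<tau> < \<bar>kruglov_sum f \<omega>\<bar>}"
    using f \<tau> by (intro kruglov_sum_tail) auto
  also have "measure unit_interval ?A = (1/2) ^ s / 2"
    using A by (simp add: measure_unit_interval)
  also have "measure kruglov_model {\<omega> \<in> space kruglov_model. \<tau> < \<bar>kruglov_sum f \<omega>\<bar>}
      = measure (distr kruglov_model borel (kruglov_sum f)) {y. \<tau> < \<bar>y\<bar>}"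
    using measurable_kruglov_sum[OF f(1)]
    by (subst measure_distr) (auto intro!: arg_cong[where f = "measure kruglov_model"])
  also have "\<dots> = distribution_fun g \<tau>"
    unfolding g(2)[symmetric] distribution_fun_def using g(1)
    by (subst measure_distr) (auto intro!: arg_cong[where f = "measure unit_interval"])
  finally show "(1/2) ^ (4 * s * k) \<le> distribution_fun g \<tau>"
    using poisson_tail_dyadic[OF \<open>2 \<le> s\<close> k] by linarith
qed (use \<open>0 \<le> c\<close> in \<open>auto simp: power_le_one\<close>)

end

section \<open>The gliding hump\<close>

context lorentz_weight
begin

text \<open>
The function is the sum of the humps \<open>c n\<close> on \<open>[0, a n / 2]\<close>. Halving the intervals is what makes
the estimate of its rearrangement by the sum over \<open>[0, a n]\<close> immediate: a point outside
\<open>[0, t/2]\<close> lies only on humps with \<open>a n > t\<close>, all of which the majorant counts at \<open>t\<close>. So the set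
where the function exceeds that value of the majorant has measure at most \<open>t/2\<close>, which is below \<open>t\<close>
or zero. The condition on \<open>a\<close> makes the sum
finite away from 0.
\<close>
lemma exists_hump_function:
  assumes a: "\<And>n. 0 < a n" "\<And>n. a n \<le> (1/2) ^ n" and c: "\<And>n. 0 \<le> c n"
    and summable: "summable (\<lambda>n. c n * \<psi> (a n))"
  obtains f where "f \<in> lorentz_space \<phi>" "\<And>u. 0 \<le> f u"
    "\<And>n u. u \<in> {0<..a n / 2} \<Longrightarrow> c n \<le> f u"
proof -
  interpret U: prob_space unit_interval by (rule prob_space_unit_interval)
  define F where "F u = (\<Sum>n. ennreal (c n) * indicator {0..a n / 2} u)" for u
  define G where "G u = (\<Sum>n. ennreal (c n) * indicator {0..a n} u)" for u
  \<comment> \<open>If the series diverges at 0, the value there becomes 0; this is why the lower bound is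
    claimed on half-open intervals.\<close>
  define f where "f u = enn2real (F u)" for u
  have a_le_1: "a n \<le> 1" for n
    using a(2)[of n] power_le_one[of "1/2 :: real" n] by linarith
  have "f \<in> borel_measurable borel"
    unfolding f_def F_def by measurable
  then have f: "f \<in> borel_measurable unit_interval"
    by (intro measurable_restrict_space1) (simp add: measurable_completion)
  have F_finite: "F u < \<infinity>" if u: "0 < u" for u
  proof -
    obtain N where N: "(1/2) ^ N < u"
      using real_arch_pow_inv[of u "1/2"] u by auto
    have "u \<notin> {0..a n / 2}" if "N \<le> n" for n
    proof -
      have "a n / 2 \<le> (1/2) ^ n" using a[of n] by simp
      also have "\<dots> \<le> (1/2) ^ N" using that by (intro power_decreasing) auto
      finally show ?thesis using N by auto
    qed
    then have "F u = (\<Sum>n<N. ennreal (c n) * indicator {0..a n / 2} u)"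
      unfolding F_def by (intro suminf_finite) auto
    also have "\<dots> < \<infinity>"
      by (auto simp: less_top[symmetric] ennreal_mult_eq_top_iff split: split_indicator)
    finally show ?thesis .
  qed
  have lower: "c n \<le> f u" if u: "u \<in> {0<..a n / 2}" for n u
  proof -
    have "ennreal (c n) = (\<Sum>k\<in>{n}. ennreal (c k) * indicator {0..a k / 2} u)"
      using u by simp
    also have "\<dots> \<le> F u"
      unfolding F_def by (intro sum_le_suminf) auto
    finally show ?thesis
      using F_finite[of u] u c[of n] unfolding f_def
      by (cases "F u") (auto simp: less_top[symmetric])
  qed
  have "rearrangement f t \<le> G t" if t: "t \<in> {0..1}" for t
  proof (cases "G t = \<infinity>")
    case False
    then obtain \<tau> where \<tau>: "0 \<le> \<tau>" "G t = ennreal \<tau>"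
      by (cases "G t") auto
    have "{s \<in> {0..1}. \<tau> < \<bar>f s\<bar>} \<subseteq> {0..t / 2}"
    proof (rule subsetI, rule ccontr)
      fix s assume s: "s \<in> {s \<in> {0..1}. \<tau> < \<bar>f s\<bar>}" "s \<notin> {0..t / 2}"
      have "F s \<le> G t"
        unfolding F_def G_def using s t
        by (intro suminf_le) (auto split: split_indicator)
      then have "f s \<le> \<tau>"
        unfolding f_def using \<tau> by (simp add: enn2real_leI)
      with s show False by (simp add: f_def)
    qed
    then have "distribution_fun f \<tau> \<le> measure unit_interval {0..t / 2}"
      unfolding distribution_fun_def
      using t by (intro U.finite_measure_mono) (auto simp: sets_restrict_space image_iff)
    also have "\<dots> = t / 2"
      using t by (subst measure_unit_interval) auto
    finally have "distribution_fun f \<tau> \<le> t / 2" .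
    moreover have "0 \<le> distribution_fun f \<tau>" by (simp add: distribution_fun_def)
    ultimately have "distribution_fun f \<tau> < t \<or> distribution_fun f \<tau> = 0" by linarith
    with \<tau> show ?thesis by (simp add: rearrangement_le)
  qed simp
  then have "lorentz_norm \<phi> f \<le> (\<Sum>n. ennreal (c n) * ennreal (\<psi> (a n)))"
    unfolding G_def using a a_le_1 by (intro lorentz_norm_le) (auto simp: less_imp_le)
  also have "\<dots> = ennreal (\<Sum>n. c n * \<psi> (a n))"
    using c summable by (subst suminf_ennreal2[symmetric]) (auto simp: ennreal_mult weight_nonneg)
  also have "\<dots> < \<infinity>" by simp
  finally have "f \<in> lorentz_space \<phi>"
    using f by (simp add: lorentz_space_def)
  then show thesis
    using lower by (intro that[of f]) (simp_all add: f_def)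
qed

text \<open>
If no constant works, there are \<open>s n \<ge> n + 2\<close> at which the quotient exceeds \<open>4\<^sup>n\<close>;
the summand \<open>n\<close> makes the intervals of length \<open>2\<^sup>-\<^sup>s\<^sup>(\<^sup>n\<^sup>) / 2\<close> shrink, and 2 is what the Poisson
tail bound asks for. Humps on these intervals with Lorentz norms at most \<open>2\<^sup>-\<^sup>n\<close> add up to a function
in the space, while each hump alone forces the norm of the Kruglov sum above \<open>4\<^sup>n 2\<^sup>-\<^sup>n = 2\<^sup>n\<close>.
\<close>
lemma kruglov_dilation_bound:
  assumes "kruglov_property (lorentz_space \<phi>)"
  obtains C S where "\<And>s. S \<le> s \<Longrightarrow>
    (\<Sum>k=1..2 ^ s. \<psi> ((1/2) ^ (4 * s * k))) \<le> C * \<psi> ((1/2) ^ s)"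
proof (rule ccontr)
  let ?T = "\<lambda>s. \<Sum>k=1..2 ^ s. \<psi> ((1/2) ^ (4 * s * k))"
  assume "\<not> thesis"
  then have "\<exists>s\<ge>n + 2. 4 ^ n * \<psi> ((1/2) ^ s) < ?T s" for n :: nat
    using that[of "n + 2" "4 ^ n"] by (meson not_le)
  then obtain s where s: "\<And>n. n + 2 \<le> s n" "\<And>n. 4 ^ n * \<psi> ((1/2) ^ s n) < ?T (s n)"
    by metis
  define a :: "nat \<Rightarrow> real" where "a n = (1/2) ^ s n" for n
  define c where "c n = 1 / (2 ^ n * \<psi> (a n))" for n
  have pos: "0 < \<psi> (a n)" for n
  proof (rule ccontr)
    assume "\<not> 0 < \<psi> (a n)"
    moreover have "\<psi> ((1/2) ^ (4 * s n * k)) \<le> \<psi> (a n)" if "k \<in> {1..2 ^ s n}" for k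
      unfolding a_def using that by (intro weight_mono power_decreasing) auto
    ultimately have "?T (s n) \<le> 0"
      by (intro sum_nonpos) force
    with s(2)[of n] weight_nonneg[of "(1/2) ^ s n"] show False
      by (smt (verit) mult_nonneg_nonneg zero_le_power)
  qed
  have c: "0 \<le> c n" for n by (simp add: c_def weight_nonneg)
  have "a n \<le> (1/2) ^ n" for n
    unfolding a_def using s(1)[of n] by (intro power_decreasing) auto
  moreover have "summable (\<lambda>n. c n * \<psi> (a n))"
  proof -
    have "(\<lambda>n. c n * \<psi> (a n)) = (\<lambda>n. (1/2) ^ n)"
      using pos by (auto simp: c_def power_divide less_imp_neq[symmetric] fun_eq_iff)
    then show ?thesis by simp
  qed
  ultimately obtain f where f: "f \<in> lorentz_space \<phi>" "\<And>u. 0 \<le> f u"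
      "\<And>n u. u \<in> {0<..a n / 2} \<Longrightarrow> c n \<le> f u"
    using c exists_hump_function[of a c] by (metis a_def zero_less_power half_gt_zero zero_less_one)
  have f_meas: "f \<in> borel_measurable unit_interval"
    using f(1) by (simp add: lorentz_space_def)
  interpret K: prob_space kruglov_model by (rule prob_space_kruglov_model)
  have "real_distribution (distr kruglov_model borel (kruglov_sum f))"
    unfolding real_distribution_def real_distribution_axioms_def
    using K.prob_space_distr[OF measurable_kruglov_sum[OF f_meas]] by simp
  then obtain g where g: "g \<in> borel_measurable unit_interval"
      "distr unit_interval borel g = distr kruglov_model borel (kruglov_sum f)"
    by (rule exists_with_distribution)
  have "g \<in> lorentz_space \<phi>"
    using assms f(1) f_meas g unfolding kruglov_property_def by blast
  then have "lorentz_norm \<phi> g < \<infinity>" by (simp add: lorentz_space_def)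
  then obtain r where r: "0 \<le> r" "lorentz_norm \<phi> g = ennreal r"
    by (cases "lorentz_norm \<phi> g") auto
  obtain n where "r < 2 ^ n"
    using real_arch_pow[of 2 r] by auto
  also have "2 ^ n = c n * (4 ^ n * \<psi> (a n))"
    using pos[of n] by (simp add: c_def field_simps power_mult_distrib[symmetric])
  also have "\<dots> \<le> c n * ?T (s n)"
    using s(2)[of n] c[of n] by (intro mult_left_mono) (auto simp: a_def)
  also have "ennreal (c n * ?T (s n)) \<le> lorentz_norm \<phi> g"
    using s(1)[of n] f f_meas g c
    by (intro kruglov_sum_lorentz_norm_ge) (auto simp: a_def)
  then have "c n * ?T (s n) \<le> r"
    using r by simp
  finally show False by simp
qed

end

theorem theorem4:
  fixes \<phi> :: "real \<Rightarrow> real"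
  assumes "mono_on {0..1} \<phi>"
    and "concave_on {0..1} \<phi>"
    and "\<phi> 0 = 0"
    and "kruglov_property (lorentz_space \<phi>)"
  shows "exp_L1 \<subseteq> lorentz_space \<phi>"
proof -
  interpret lorentz_weight \<phi>
    using assms by unfold_locales
  obtain C S where "\<And>s. S \<le> s \<Longrightarrow>
      (\<Sum>k=1..2 ^ s. \<psi> ((1/2) ^ (4 * s * k))) \<le> C * \<psi> ((1/2) ^ s)"
    using kruglov_dilation_bound[OF assms(4)] by blast
  then have "summable (\<lambda>k. \<psi> ((1/2) ^ k))"
    by (intro summable_if_dilation_bounded[where d = "\<lambda>k. \<psi> ((1/2) ^ k)"])
      (auto intro!: antimonoI weight_mono power_decreasing simp: weight_nonneg)
  then show ?thesis by (rule exp_L1_subset_lorentz_space)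
qed

end
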